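(* Let $f\in\mathcal{S}^{*}_{\mathcal{B}}$. Then $|H_3(1)|\leq \frac{1}{36}$. This result is sharp, that is, there exists $f\in\mathcal{S}^{*}_{\mathcal{B}}$ for which equality holds.
   Context: Let $\mathbb{D}=\{z\in\mathbb{C}:|z|<1\}$. Let $\mathcal{A}$ be the class of analytic functions $f$ on $\mathbb{D}$ of the form $f(z)=z+\sum_{n=2}^{\infty}a_nz^n$. For analytic functions $h,g$ on $\mathbb{D}$, $h\prec g$ ($h$ is subordinate to $g$) means that there is an analytic function $w$ on $\mathbb{D}$ with $w(0)=0$ and $|w(z)|\le |z|$ (a Schwarz function) such that $h(z)=g(w(z))$ for $z \in \mathbb{D}$. The class $\mathcal{S}^{*}_{\mathcal{B}}$ is $$\mathcal{S}^{*}_{\mathcal{B}}=\left\{f\in\mathcal{A}:\ \frac{zf'(z)}{f(z)}\prec\sqrt{1+\tanh z}\right\},$$ where the branch of the square root is the one with value $1$ at $z=0$. For $f(z)=z+\sum_{n=2}^{\infty}a_nz^n\in\mathcal{A}$ with $a_1:=1$, the Hankel determinant $H_q(n)$ ($q,n\in\mathbb{N}$) is the determinant of the $q\times q$ matrix whose $(i,j)$ entry is $a_{n+i+j-2}$, $1\le i,j\le q$. In particular, $H_3(1)=2a_2a_3a_4-a_3^3-a_4^2-a_2^2a_5+a_3a_5$. *)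

theory Defs
  imports "HOL-Complex_Analysis.Complex_Analysis" "Jordan_Normal_Form.Determinant"
begin

definition taylor_coeff :: "(complex \<Rightarrow> complex) \<Rightarrow> nat \<Rightarrow> complex" where
  "taylor_coeff f n = fps_nth (fps_expansion f 0) n"

(* Functions of the disc are total functions on the complex plane; only their values on
   the open unit disc matter. *)

definition class_A :: "(complex \<Rightarrow> complex) set" where
  "class_A = {f. f holomorphic_on ball 0 1 \<and>
     (\<forall>z\<in>ball 0 1. (\<lambda>n. taylor_coeff f (n + 2) * z ^ (n + 2)) sums (f z - z))}"

definition schwarz_function :: "(complex \<Rightarrow> complex) \<Rightarrow> bool" where
  "schwarz_function w \<longleftrightarrow>
     w holomorphic_on ball 0 1 \<and> w 0 = 0 \<and> (\<forall>z\<in>ball 0 1. norm (w z) \<le> norm z)"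

definition subordinate :: "(complex \<Rightarrow> complex) \<Rightarrow> (complex \<Rightarrow> complex) \<Rightarrow> bool"
    (infix \<open>\<prec>\<^sub>D\<close> 50) where
  "h \<prec>\<^sub>D g \<longleftrightarrow> h holomorphic_on ball 0 1 \<and> g holomorphic_on ball 0 1 \<and>
     (\<exists>w. schwarz_function w \<and> (\<forall>z\<in>ball 0 1. h z = g (w z)))"

(* The quotient z f'(z) / f(z), with its removable singularity at the origin filled in:
   the limit there is 1 for every f in class_A (lemma starlike_quotient_tendsto).  Should f
   vanish at another point of the disc, the quotient gets the junk value x / 0 = 0 there; such
   an f is not in S_B below, because sqrt (1 + tanh) has no zero on the disc. *)
definition starlike_quotient :: "(complex \<Rightarrow> complex) \<Rightarrow> complex \<Rightarrow> complex" where
  "starlike_quotient f z = (if z = 0 then 1 else z * deriv f z / f z)"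

(* The principal root csqrt is the required branch: 1 + tanh z avoids the slit of csqrt for
   |z| < 1 (lemmas one_plus_tanh_slit and csqrt_tanh_holomorphic), and the value at 0 is 1. *)
definition S_B :: "(complex \<Rightarrow> complex) set" where
  "S_B = {f \<in> class_A. starlike_quotient f \<prec>\<^sub>D (\<lambda>z. csqrt (1 + tanh z))}"

(* Matrix indices start at 0 here, so the (i,j) entry a_(n+i+j-2) of the 1-based convention
   becomes a_(n+i+j). The determinant is named by its theory because the HOL-Analysis one,
   for matrices of type-indexed size, is also in scope. *)
definition hankel_det :: "(complex \<Rightarrow> complex) \<Rightarrow> nat \<Rightarrow> nat \<Rightarrow> complex" where
  "hankel_det f q n =
     Determinant.det (Matrix.mat q q (\<lambda>(i, j). taylor_coeff f (n + i + j)))"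

lemma one_plus_tanh_slit:
  fixes z :: complex
  assumes "norm z < 1"
  shows "cosh z \<noteq> 0" "1 + tanh z \<notin> \<real>\<^sub>\<le>\<^sub>0"
proof -
  define e where "e = exp (-(2 * z))"
  have im: "\<bar>Im z\<bar> < 1" using assms abs_Im_le_cmod[of z] by linarith
  have pos: "Re e > 0" if "Im e = 0"
  proof -
    have "sin (2 * Im z) = 0" using that by (simp add: e_def Im_exp)
    moreover have "\<bar>2 * Im z\<bar> < pi" using im pi_gt3 by linarith
    ultimately have "Im z = 0"
      by (metis abs_zero mult_eq_0_iff sin_eq_0_pi zero_neq_numeral abs_less_iff minus_less_iff)
    thus ?thesis by (simp add: e_def Re_exp)
  qed
  have e1: "1 + e \<noteq> 0"
  proof
    assume "1 + e = 0"
    hence "e = -1" by (simp add: add_eq_0_iff)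
    with pos show False by simp
  qed
  have ch: "2 * cosh z = exp z * (1 + e)"
    by (simp add: cosh_field_def e_def algebra_simps flip: exp_add)
  thus c: "cosh z \<noteq> 0" using e1 by auto
  have "1 + tanh z = (sinh z + cosh z) / cosh z"
    using c by (simp add: tanh_def add_divide_distrib)
  also have "\<dots> = (2 * exp z) / (2 * cosh z)" by (simp add: sinh_plus_cosh)
  also have "\<dots> = 2 / (1 + e)" unfolding ch by simp
  finally have t: "1 + tanh z = 2 / (1 + e)" .
  show "1 + tanh z \<notin> \<real>\<^sub>\<le>\<^sub>0"
  proof
    assume "1 + tanh z \<in> \<real>\<^sub>\<le>\<^sub>0"
    then obtain r :: real where r: "1 + tanh z = of_real r" "r \<le> 0"
      by (auto elim!: nonpos_Reals_cases)
    have "of_real r * (1 + e) = 2" using t r(1) e1 by (metis nonzero_divide_eq_eq)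
    hence m: "(1 + e) * of_real r = 2" and "r \<noteq> 0" by (auto simp: mult.commute)
    hence "1 + e = of_real (2 / r)" by (simp add: eq_divide_eq)
    hence "e = of_real (2 / r - 1)" by (simp add: algebra_simps)
    hence "Im e = 0" "Re e = 2 / r - 1" by (simp_all only: Im_complex_of_real Re_complex_of_real)
    moreover have "2 / r \<le> 0" using r(2) by (simp add: divide_nonneg_nonpos)
    ultimately show False using pos by linarith
  qed
qed

lemma csqrt_tanh_holomorphic:
  "(\<lambda>z. csqrt (1 + tanh z)) holomorphic_on ball 0 1"
proof (intro holomorphic_on_csqrt')
  have "(tanh :: complex \<Rightarrow> complex) analytic_on ball 0 1"
    using one_plus_tanh_slit(1) by (intro analytic_on_tanh) auto
  thus "(\<lambda>z::complex. 1 + tanh z) holomorphic_on ball 0 1"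
    by (intro holomorphic_intros analytic_imp_holomorphic)
qed (use one_plus_tanh_slit(2) in auto)

lemma class_A_coeffs:
  assumes "f \<in> class_A"
  shows "f 0 = 0" "deriv f 0 = 1" "taylor_coeff f 0 = 0" "taylor_coeff f 1 = 1"
proof -
  have hol: "f holomorphic_on ball 0 1"
    and s: "\<And>z. z \<in> ball 0 1 \<Longrightarrow> (\<lambda>n. taylor_coeff f (n + 2) * z ^ (n + 2)) sums (f z - z)"
    using assms by (auto simp: class_A_def)
  have tc: "taylor_coeff f n = (deriv ^^ n) f 0 / fact n" for n
    by (simp add: taylor_coeff_def fps_expansion_def)
  have "(\<lambda>n. 0) sums f 0" using s[of 0] by simp
  thus f0: "f 0 = 0" using sums_unique2 sums_zero by blast
  have "(\<lambda>n. taylor_coeff f n * z ^ n) sums f z" if "z \<in> ball 0 1" for z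
    using holomorphic_power_series[OF hol that] by (simp add: tc)
  hence "(\<lambda>n. taylor_coeff f (n + 2) * z ^ (n + 2)) sums (f z - (\<Sum>i<2. taylor_coeff f i * z ^ i))"
    if "z \<in> ball 0 1" for z
    using that sums_iff_shift'[of "\<lambda>n. taylor_coeff f n * z ^ n" 2 "f z"] by blast
  hence "f z - z = f z - (\<Sum>i<2. taylor_coeff f i * z ^ i)" if "z \<in> ball 0 1" for z
    using that s sums_unique2 by blast
  hence "z = deriv f 0 * z" if "z \<in> ball 0 1" for z
    using that by (simp add: tc f0 numeral_2_eq_2)
  from this[of "1/2"] show d: "deriv f 0 = 1" by simp
  show "taylor_coeff f 0 = 0" "taylor_coeff f 1 = 1" by (simp_all add: tc f0 d)
qed

lemma starlike_quotient_tendsto: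
  assumes "f \<in> class_A"
  shows "(\<lambda>z. z * deriv f z / f z) \<midarrow>0\<rightarrow> 1"
proof -
  have hol: "f holomorphic_on ball 0 1" using assms by (auto simp: class_A_def)
  have "(f has_field_derivative 1) (at 0)"
    using holomorphic_derivI[OF hol, of 0] class_A_coeffs(2)[OF assms] by simp
  hence 1: "(\<lambda>z. f z / z) \<midarrow>0\<rightarrow> 1"
    by (simp add: has_field_derivative_iff class_A_coeffs(1)[OF assms])
  have "continuous_on (ball 0 1) (deriv f)"
    by (intro holomorphic_on_imp_continuous_on holomorphic_deriv hol) auto
  hence "deriv f \<midarrow>0\<rightarrow> 1"
    using class_A_coeffs(2)[OF assms]
    by (auto simp: continuous_on_eq_continuous_at isCont_def dest: bspec[where x = 0])
  from tendsto_divide[OF this 1] show ?thesis by (simp add: mult.commute)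
qed

lemma det_mat_2:
  "Determinant.det (Matrix.mat 2 2 g) = g (0, 0) * g (1, 1) - g (0, 1) * (g (1, 0) :: complex)"
proof -
  have "Determinant.det (Matrix.mat 2 2 g) =
      (\<Sum>j<2. Matrix.mat 2 2 g $$ (0, j) * cofactor (Matrix.mat 2 2 g) 0 j)"
    by (rule laplace_expansion_row) auto
  thus ?thesis
    by (simp add: numeral_2_eq_2 lessThan_Suc cofactor_def mat_delete_def det_single)
qed

lemma det_mat_3:
  fixes g :: "nat \<times> nat \<Rightarrow> complex"
  shows "Determinant.det (Matrix.mat 3 3 g) =
    g (0, 0) * (g (1, 1) * g (2, 2) - g (1, 2) * g (2, 1)) -
    g (0, 1) * (g (1, 0) * g (2, 2) - g (1, 2) * g (2, 0)) +
    g (0, 2) * (g (1, 0) * g (2, 1) - g (1, 1) * g (2, 0))"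
proof -
  have minor: "mat_delete (Matrix.mat 3 3 g) 0 j =
      Matrix.mat 2 2 (\<lambda>(i, k). g (Suc i, if k < j then k else Suc k))" if "j < 3" for j
    using that by (intro eq_matI) (auto simp: mat_delete_def)
  have "Determinant.det (Matrix.mat 3 3 g) =
      (\<Sum>j<3. Matrix.mat 3 3 g $$ (0, j) * cofactor (Matrix.mat 3 3 g) 0 j)"
    by (rule laplace_expansion_row) auto
  also have "\<dots> = (\<Sum>j<3. g (0, j) * ((-1) ^ j *
      Determinant.det (Matrix.mat 2 2 (\<lambda>(i, k). g (Suc i, if k < j then k else Suc k)))))"
    by (intro sum.cong) (auto simp: cofactor_def minor)
  finally show ?thesis
    by (simp add: det_mat_2 numeral_3_eq_3 lessThan_Suc) (simp add: numeral_2_eq_2 algebra_simps)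
qed

lemma hankel_det_3_1:
  assumes "f \<in> class_A"
  defines "a \<equiv> taylor_coeff f"
  shows "hankel_det f 3 1 =
    2 * a 2 * a 3 * a 4 - a 3 ^ 3 - a 4 ^ 2 - a 2 ^ 2 * a 5 + a 3 * a 5"
proof -
  have "a 1 = 1" using class_A_coeffs(4)[OF assms(1)] by (simp add: a_def)
  thus ?thesis
    unfolding hankel_det_def det_mat_3 a_def[symmetric]
    by (simp add: algebra_simps power2_eq_square power3_eq_cube flip: numeral_eq_Suc)
      (simp add: eval_nat_numeral)
qed

end

theory Submission
  imports Defs
begin

text \<open>
  If z f'(z) / f(z) = p(z) with p = sqrt (1 + tanh w) for a Schwarz function w, then H_3(1) is a
  polynomial in the first four Taylor coefficients of w. The Schur algorithm applied to w(z) / z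
  expresses these coefficients through free parameters a, x, y, u of the closed unit disc, and the
  polynomial becomes A + s t y B + s t y^2 C + s t (1 - |y|^2) u D, where s = 1 - |a|^2,
  t = 1 - |x|^2 and A, B, C, D depend on a and x only. As the last two terms are weighted by
  |y|^2 and 1 - |y|^2, the triangle inequality leaves two polynomial inequalities in the real
  variables |a| and |x| on the unit square. The only extremal point is a = x = 0, |y| = 1, that is,
  w(z) = c z^3 with |c| = 1, which also gives the extremal function.
\<close>

section \<open>Functional equations on the disc as power series identities\<close>

lemma fps_mult_nth_le_5:
  fixes f g :: "complex fps"
  shows "fps_nth (f * g) 0 = fps_nth f 0 * fps_nth g 0"
    and "fps_nth (f * g) 1 = fps_nth f 0 * fps_nth g 1 + fps_nth f 1 * fps_nth g 0"
    and "fps_nth (f * g) 2 =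
      fps_nth f 0 * fps_nth g 2 + fps_nth f 1 * fps_nth g 1 + fps_nth f 2 * fps_nth g 0"
    and "fps_nth (f * g) 3 =
      fps_nth f 0 * fps_nth g 3 + fps_nth f 1 * fps_nth g 2 + fps_nth f 2 * fps_nth g 1 +
      fps_nth f 3 * fps_nth g 0"
    and "fps_nth (f * g) 4 =
      fps_nth f 0 * fps_nth g 4 + fps_nth f 1 * fps_nth g 3 + fps_nth f 2 * fps_nth g 2 +
      fps_nth f 3 * fps_nth g 1 + fps_nth f 4 * fps_nth g 0"
    and "fps_nth (f * g) 5 =
      fps_nth f 0 * fps_nth g 5 + fps_nth f 1 * fps_nth g 4 + fps_nth f 2 * fps_nth g 3 +
      fps_nth f 3 * fps_nth g 2 + fps_nth f 4 * fps_nth g 1 + fps_nth f 5 * fps_nth g 0"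
  by (simp_all add: fps_mult_nth numeral_eq_Suc)

lemma has_fps_expansion_disc:
  "f holomorphic_on ball 0 1 \<Longrightarrow> f has_fps_expansion fps_expansion f 0"
  by (rule has_fps_expansion_fps_expansion[of "ball 0 1"]) auto

text \<open>The germ at 0 determines the expansion. The Schur step and both differential equations
  below are turned into coefficient recursions by this rule.\<close>

lemma has_fps_expansion_disc_eqI:
  fixes f g :: "complex \<Rightarrow> complex"
  assumes "f has_fps_expansion F" "g has_fps_expansion G" "\<And>z. z \<in> ball 0 1 \<Longrightarrow> f z = g z"
  shows "F = G"
proof -
  have "eventually (\<lambda>z. z \<in> ball 0 1) (nhds (0::complex))"
    by (intro eventually_nhds_in_open) auto
  hence "eventually (\<lambda>z. f z = g z) (nhds 0)"
    by (rule eventually_mono) (use assms(3) in auto)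
  hence "f has_fps_expansion G"
    using assms(2) has_fps_expansion_cong by blast
  thus ?thesis
    using assms(1) fps_expansion_unique_complex by blast
qed

section \<open>The Schur algorithm\<close>

text \<open>The bound is not strict, so unimodular constants, at which the Schur algorithm stops,
  are included.\<close>

definition schur_function :: "(complex \<Rightarrow> complex) \<Rightarrow> bool" where
  "schur_function v \<longleftrightarrow> v holomorphic_on ball 0 1 \<and> (\<forall>z\<in>ball 0 1. norm (v z) \<le> 1)"

lemma schur_function_coeff_0: "schur_function v \<Longrightarrow> norm (taylor_coeff v 0) \<le> 1"
  by (simp add: schur_function_def taylor_coeff_def fps_expansion_def)

text \<open>The Schwarz lemma, stated for the quotient f(z) / z with its singularity removed: away
  from 0 the bound is |f(z)| \<le> |z|, at 0 it is |f'(0)| \<le> 1.\<close>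

lemma schwarz_quotient:
  assumes "f holomorphic_on ball 0 1" "f 0 = 0" "\<And>z. norm z < 1 \<Longrightarrow> norm (f z) < 1"
  obtains h where "schur_function h" "\<And>z. z \<in> ball 0 1 \<Longrightarrow> f z = z * h z"
proof -
  obtain h where h: "h holomorphic_on ball 0 1" "\<And>z. norm z < 1 \<Longrightarrow> f z = z * h z" "deriv f 0 = h 0"
    using Schwarz3[OF assms(1,2)] by blast
  have "norm (h z) \<le> 1" if "norm z < 1" for z
  proof (cases "z = 0")
    case True
    thus ?thesis using Schwarz_Lemma(2)[OF assms that] h(3) by simp
  next
    case False
    have "norm z * norm (h z) \<le> norm z"
      using Schwarz_Lemma(1)[OF assms that] h(2)[OF that] by (simp add: norm_mult)
    thus ?thesis using False by simp
  qed
  with h show ?thesis by (intro that[of h]) (auto simp: schur_function_def)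
qed

text \<open>The disc automorphism that sends \<open>w 0\<close> to 0, composed with
  \<open>w\<close>, vanishes at 0, and \<open>v\<close> is its quotient by z. The denominator 1 -
  cnj (w 0) * w z is cleared so that coefficients can be compared.\<close>

lemma schur_step:
  assumes "schur_function w"
  obtains v where "schur_function v"
    "\<And>z. z \<in> ball 0 1 \<Longrightarrow> w z = w 0 + z * (v z - cnj (w 0) * (v z * w z))"
proof (cases "\<exists>z\<in>ball 0 1. norm (w z) = 1")
  case True
  then obtain \<xi> where \<xi>: "\<xi> \<in> ball 0 1" "norm (w \<xi>) = 1" by blast
  \<comment> \<open>No automorphism is available if |w 0| = 1. By the maximum principle
    \<open>w\<close> is then constant, and v = 0 satisfies the equation.\<close>
  have "w constant_on ball 0 1"
    by (rule maximum_modulus_principle[of w _ "ball 0 1" \<xi>])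
      (use assms \<xi> in \<open>auto simp: schur_function_def\<close>)
  then obtain c where c: "\<forall>z\<in>ball 0 1. w z = c"
    unfolding constant_on_def by blast
  show ?thesis
    by (rule that[of "\<lambda>_. 0"]) (use c in \<open>simp_all add: schur_function_def\<close>)
next
  case False
  have w: "w holomorphic_on ball 0 1" "\<And>z. norm z < 1 \<Longrightarrow> norm (w z) < 1"
    using assms False by (force simp: schur_function_def less_le)+
  define g where "g = Moebius_function 0 (w 0) \<circ> w"
  have "g holomorphic_on ball 0 1"
    unfolding g_def
    by (rule holomorphic_on_compose_gen[OF w(1) Moebius_function_holomorphic]) (use w(2) in auto)
  moreover have "g 0 = 0"
    by (simp add: g_def Moebius_function_eq_zero)
  moreover have "norm (g z) < 1" if "norm z < 1" for z
    using w(2) that by (simp add: g_def Moebius_function_norm_lt_1)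
  ultimately obtain v where v: "schur_function v" "\<And>z. z \<in> ball 0 1 \<Longrightarrow> g z = z * v z"
    using schwarz_quotient[of g] by metis
  show ?thesis
  proof (rule that[OF v(1)])
    fix z :: complex assume z: "z \<in> ball 0 1"
    have "norm (cnj (w 0) * w z) < 1"
      using norm_mult_less[of "cnj (w 0)" 1 "w z" 1] w(2) z by simp
    hence "1 - cnj (w 0) * w z \<noteq> 0" by auto
    moreover have "(w z - w 0) / (1 - cnj (w 0) * w z) = z * v z"
      using v(2)[OF z] by (simp add: g_def Moebius_function_simple)
    ultimately have "w z - w 0 = z * v z * (1 - cnj (w 0) * w z)"
      by (simp add: divide_eq_eq)
    thus "w z = w 0 + z * (v z - cnj (w 0) * (v z * w z))"
      by (simp add: algebra_simps)
  qed
qed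

text \<open>The coefficient of index n of \<open>v * w\<close> contains v_n * b_0; joined with the
  lone v_n, it produces the factor \<open>s\<close>.\<close>

lemma schur_step_coeffs:
  assumes "schur_function w"
  defines "b \<equiv> taylor_coeff w"
  defines "s \<equiv> 1 - b 0 * cnj (b 0)"
  obtains v where "schur_function v"
    "b 1 = s * taylor_coeff v 0"
    "b 2 = s * taylor_coeff v 1 - cnj (b 0) * (taylor_coeff v 0 * b 1)"
    "b 3 = s * taylor_coeff v 2 - cnj (b 0) * (taylor_coeff v 0 * b 2 + taylor_coeff v 1 * b 1)"
proof -
  obtain v where v: "schur_function v"
    "\<And>z. z \<in> ball 0 1 \<Longrightarrow> w z = w 0 + z * (v z - cnj (w 0) * (v z * w z))"
    using schur_step[OF assms(1)] by blast
  define V where "V = fps_expansion v 0"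
  define W where "W = fps_expansion w 0"
  have W: "w has_fps_expansion W" and V: "v has_fps_expansion V"
    using assms(1) v(1) has_fps_expansion_disc by (auto simp: schur_function_def W_def V_def)
  have "(\<lambda>z. w 0 + z * (v z - cnj (w 0) * (v z * w z))) has_fps_expansion
      fps_const (w 0) + fps_X * (V - fps_const (cnj (w 0)) * (V * W))"
    by (intro fps_expansion_intros V W)
  hence "W = fps_const (w 0) + fps_X * (V - fps_const (cnj (w 0)) * (V * W))"
    using has_fps_expansion_disc_eqI W v(2) by blast
  hence "fps_nth W n = fps_nth (fps_const (w 0) + fps_X * (V - fps_const (cnj (w 0)) * (V * W))) n" for n
    by simp
  hence W_Suc: "fps_nth W (Suc n) = fps_nth V n - cnj (w 0) * fps_nth (V * W) n" for n
    by simp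
  have b: "b = fps_nth W" and tv: "taylor_coeff v = fps_nth V"
    by (auto simp: b_def W_def V_def taylor_coeff_def)
  have w0: "w 0 = b 0"
    by (simp add: b_def taylor_coeff_def fps_expansion_def)
  show ?thesis
    by (rule that[OF v(1)]; unfold s_def tv)
      (use W_Suc[of 0] W_Suc[of 1] W_Suc[of 2]
       in \<open>simp_all add: fps_mult_nth_le_5 w0 flip: b\<close>;
       simp add: algebra_simps eval_nat_numeral)+
qed

text \<open>Three Schur steps lead from \<open>w\<close> to \<open>v1\<close>, \<open>v2\<close>,
  \<open>v3\<close>; the parameters a, x, y, u are the values of these four functions at 0.\<close>

lemma schur_parameters:
  assumes "schur_function w"
  obtains a x y u where "norm a \<le> 1" "norm x \<le> 1" "norm y \<le> 1" "norm u \<le> 1"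
    "taylor_coeff w 0 = a"
    "taylor_coeff w 1 = (1 - a * cnj a) * x"
    "taylor_coeff w 2 = (1 - a * cnj a) * ((1 - x * cnj x) * y - cnj a * x^2)"
    "taylor_coeff w 3 = (1 - a * cnj a) *
      ((1 - x * cnj x) * ((1 - y * cnj y) * u - cnj x * y^2 - 2 * cnj a * x * y) + (cnj a)^2 * x^3)"
proof -
  obtain v1 where v1: "schur_function v1"
    "taylor_coeff w 1 = (1 - taylor_coeff w 0 * cnj (taylor_coeff w 0)) * taylor_coeff v1 0"
    "taylor_coeff w 2 = (1 - taylor_coeff w 0 * cnj (taylor_coeff w 0)) * taylor_coeff v1 1 -
      cnj (taylor_coeff w 0) * (taylor_coeff v1 0 * taylor_coeff w 1)"
    "taylor_coeff w 3 = (1 - taylor_coeff w 0 * cnj (taylor_coeff w 0)) * taylor_coeff v1 2 -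
      cnj (taylor_coeff w 0) *
      (taylor_coeff v1 0 * taylor_coeff w 2 + taylor_coeff v1 1 * taylor_coeff w 1)"
    using schur_step_coeffs[OF assms] by metis
  obtain v2 where v2: "schur_function v2"
    "taylor_coeff v1 1 = (1 - taylor_coeff v1 0 * cnj (taylor_coeff v1 0)) * taylor_coeff v2 0"
    "taylor_coeff v1 2 = (1 - taylor_coeff v1 0 * cnj (taylor_coeff v1 0)) * taylor_coeff v2 1 -
      cnj (taylor_coeff v1 0) * (taylor_coeff v2 0 * taylor_coeff v1 1)"
    using schur_step_coeffs[OF v1(1)] by metis
  obtain v3 where v3: "schur_function v3"
    "taylor_coeff v2 1 = (1 - taylor_coeff v2 0 * cnj (taylor_coeff v2 0)) * taylor_coeff v3 0"
    using schur_step_coeffs[OF v2(1)] by metis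
  show ?thesis
  proof (rule that)
    show "norm (taylor_coeff w 0) \<le> 1" "norm (taylor_coeff v1 0) \<le> 1"
      "norm (taylor_coeff v2 0) \<le> 1" "norm (taylor_coeff v3 0) \<le> 1"
      using assms v1(1) v2(1) v3(1) by (simp_all add: schur_function_coeff_0)
  qed (simp_all only: v1 v2 v3, simp_all add: algebra_simps power2_eq_square power3_eq_cube)
qed

section \<open>The bound for the coefficient polynomial\<close>

text \<open>H_3(1) as a function of the Taylor coefficients c1, ..., c4 of the Schwarz function.\<close>

definition hankel_poly :: "complex \<Rightarrow> complex \<Rightarrow> complex \<Rightarrow> complex \<Rightarrow> complex" where
  "hankel_poly c1 c2 c3 c4 =
    (10944 * c1 * c2 * c3 - 9648 * c1^2 * c2^2 - 7776 * c1^2 * c4 + 7152 * c1^3 * c3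
      + 3084 * c1^4 * c2 - 1099 * c1^6 + 10368 * c2 * c4 - 5184 * c2^3 - 9216 * c3^2) / 331776"

text \<open>In the application, a', x', y' are the complex conjugates of a, x, y.\<close>

lemma hankel_poly_schur:
  fixes a a' x x' y y' u :: complex
  assumes "q = a * a'" "p = x * x'"
  shows "331776 * hankel_poly a ((1 - q) * x) ((1 - q) * ((1 - p) * y - a' * x^2))
      ((1 - q) * ((1 - p) * ((1 - y * y') * u - x' * y^2 - 2 * a' * x * y) + a'^2 * x^3))
    = - 1099 * a^6
      + (1 - q) * (3084 * a^4 * x - 48 * a^2 * (201 - 52 * q) * x^2
          - 288 * (18 + 2 * q + 7 * q^2) * x^3 + 1152 * a'^2 * (1 - q) * x^4
        + (1 - p) * (y * (7152 * a^3 + 576 * a * (19 + 8 * q) * x - 2304 * a' * (1 - q) * x^2)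
          + (y^2 * (7776 * a^2 * x' - 1152 * (1 - q) * (8 + p))
          + (1 - y * y') * u * (10368 * (1 - q) * x - 7776 * a^2))))"
proof -
  have h: "331776 * hankel_poly c1 c2 c3 c4 =
    10944 * c1 * c2 * c3 - 9648 * c1^2 * c2^2 - 7776 * c1^2 * c4 + 7152 * c1^3 * c3
      + 3084 * c1^4 * c2 - 1099 * c1^6 + 10368 * c2 * c4 - 5184 * c2^3 - 9216 * c3^2" for c1 c2 c3 c4
    by (simp add: hankel_poly_def)
  show ?thesis
    unfolding h assms by (simp add: algebra_simps power_numeral_reduce)
qed

text \<open>
  The right-hand side T of the next two bounds is chosen such that 1099 a^6 + (1 - a^2) T \<le> 9216.
  The proofs expand the difference in the Bernstein basis of the unit square. In the first bound
  equality holds at a = r = 0, where the mixed term - 10944 a r makes a Bernstein coefficient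
  negative unless the square (r - a)^2 is split off.
\<close>

lemma hankel_bound_C:
  fixes a r :: real
  assumes "0 \<le> a" "a \<le> 1" "0 \<le> r" "r \<le> 1"
  shows "3084 * a^4 * r + 48 * a^2 * (201 - 52 * a^2) * r^2 + 288 * (18 + 2 * a^2 + 7 * a^4) * r^3
      + 1152 * a^2 * (1 - a^2) * r^4
      + (1 - r^2) * (7152 * a^3 + 576 * a * (19 + 8 * a^2) * r + 2304 * a * (1 - a^2) * r^2
        + 1152 * (1 - a^2) * (8 + r^2) + 7776 * a^2 * r)
    \<le> 9216 + 8117 * a^2 + 8117 * a^4" (is "?l \<le> ?r")
proof -
  define b q where "b = 1 - a" and "q = 1 - r"
  have nonneg: "b \<ge> 0" "q \<ge> 0" using assms by (simp_all add: b_def q_def)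
  have "?r - ?l =
      2736 * (2 - r^2) * (r - a)^2 +
      b^4 * (2592 * r^2 * q^4 + 5184 * r^3 * q^3 + 3888 * r^4 * q^2 + 2592 * r^5 * q + 1296 * r^6) +
      a * b^3 * (8064 * r^2 * q^4 + 16992 * r^3 * q^3 + 20448 * r^4 * q^2 + 22176 * r^5 * q + 10656 * r^6) +
      a^2 * b^2 * (11861 * q^6 + 63390 * r * q^5 + 132699 * r^2 * q^4 + 126628 * r^3 * q^3 + 67611 * r^4 * q^2 + 40350 * r^5 * q + 18197 * r^6) +
      a^3 * b * (16570 * q^6 + 79260 * r * q^5 + 130710 * r^2 * q^4 + 76328 * r^3 * q^3 + 4326 * r^4 * q^2 + 5628 * r^5 * q + 9610 * r^6) +
      a^4 * (12826 * q^6 + 61488 * r * q^5 + 112314 * r^2 * q^4 + 100976 * r^3 * q^3 + 54270 * r^4 * q^2 + 24384 * r^5 * q + 7438 * r^6)"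
    unfolding b_def q_def by (simp add: algebra_simps power_numeral_reduce)
  also have "\<dots> \<ge> 0"
    using assms nonneg power_le_one[of r 2] by (intro add_nonneg_nonneg mult_nonneg_nonneg) auto
  finally show ?thesis by simp
qed

lemma hankel_bound_D:
  fixes a r :: real
  assumes "0 \<le> a" "a \<le> 1" "0 \<le> r" "r \<le> 1"
  shows "3084 * a^4 * r + 48 * a^2 * (201 - 52 * a^2) * r^2 + 288 * (18 + 2 * a^2 + 7 * a^4) * r^3
      + 1152 * a^2 * (1 - a^2) * r^4
      + (1 - r^2) * (7152 * a^3 + 576 * a * (19 + 8 * a^2) * r + 2304 * a * (1 - a^2) * r^2
        + 7776 * a^2 + 10368 * (1 - a^2) * r)
    \<le> 9216 + 8117 * a^2 + 8117 * a^4" (is "?l \<le> ?r")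
proof -
  define b q where "b = 1 - a" and "q = 1 - r"
  have nonneg: "b \<ge> 0" "q \<ge> 0" using assms by (simp_all add: b_def q_def)
  have "?r - ?l =
      b^5 * (9216 * q^5 + 35712 * r * q^4 + 50688 * r^2 * q^3 + 35136 * r^3 * q^2 + 14976 * r^4 * q + 4032 * r^5) +
      a * b^4 * (46080 * q^5 + 167616 * r * q^4 + 207360 * r^2 * q^3 + 114048 * r^3 * q^2 + 48384 * r^4 * q + 20160 * r^5) +
      a^2 * b^3 * (92501 * q^5 + 325417 * r * q^4 + 365570 * r^2 * q^3 + 153890 * r^3 * q^2 + 58297 * r^4 * q + 37061 * r^5) +
      a^3 * b^2 * (86031 * q^5 + 287307 * r * q^4 + 278934 * r^2 * q^3 + 62550 * r^3 * q^2 + 15435 * r^4 * q + 30543 * r^5) +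
      a^4 * b * (40916 * q^5 + 127768 * r * q^4 + 108488 * r^2 * q^3 + 12080 * r^3 * q^2 + 7492 * r^4 * q + 17048 * r^5) +
      a^5 * (10522 * q^5 + 33974 * r * q^4 + 38452 * r^2 * q^3 + 24508 * r^3 * q^2 + 16946 * r^4 * q + 7438 * r^5)"
    unfolding b_def q_def by (simp add: algebra_simps power_numeral_reduce)
  also have "\<dots> \<ge> 0"
    using assms nonneg by (intro add_nonneg_nonneg mult_nonneg_nonneg) auto
  finally show ?thesis by simp
qed

text \<open>Together with \<open>norm_triangle_mono\<close>, this rule and the next let
  \<open>intro\<close> bound a polynomial expression by following its syntax.\<close>

lemma norm_diff_mono:
  fixes x y :: "'a::real_normed_vector"
  shows "norm x \<le> r \<Longrightarrow> norm y \<le> s \<Longrightarrow> norm (x - y) \<le> r + s"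
  by (rule norm_triangle_le_diff) (rule add_mono)

lemma norm_mult_mono:
  fixes x y :: "'a::real_normed_div_algebra"
  shows "norm x \<le> r \<Longrightarrow> norm y \<le> s \<Longrightarrow> norm (x * y) \<le> r * s"
  by (simp add: norm_mult mult_mono')

text \<open>After the triangle inequality, the estimate is a convex combination, with weights |y|^2
  and 1 - |y|^2, of \<open>hankel_bound_C\<close> and \<open>hankel_bound_D\<close>.\<close>

lemma norm_hankel_poly_le:
  fixes a x y u :: complex
  assumes "norm a \<le> 1" "norm x \<le> 1" "norm y \<le> 1" "norm u \<le> 1"
  shows "norm (hankel_poly a ((1 - a * cnj a) * x)
      ((1 - a * cnj a) * ((1 - x * cnj x) * y - cnj a * x^2))
      ((1 - a * cnj a) * ((1 - x * cnj x) * ((1 - y * cnj y) * u - cnj x * y^2 - 2 * cnj a * x * y)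
        + (cnj a)^2 * x^3))) \<le> 1 / 36"
    (is "norm ?H \<le> _")
proof -
  define \<alpha> \<rho> \<eta> where "\<alpha> = norm a" and "\<rho> = norm x" and "\<eta> = norm y"
  define A where "A = 3084 * \<alpha>^4 * \<rho> + 48 * \<alpha>^2 * (201 - 52 * \<alpha>^2) * \<rho>^2
    + 288 * (18 + 2 * \<alpha>^2 + 7 * \<alpha>^4) * \<rho>^3 + 1152 * \<alpha>^2 * (1 - \<alpha>^2) * \<rho>^4"
  define B where "B = 7152 * \<alpha>^3 + 576 * \<alpha> * (19 + 8 * \<alpha>^2) * \<rho> + 2304 * \<alpha> * (1 - \<alpha>^2) * \<rho>^2"
  define C where "C = 7776 * \<alpha>^2 * \<rho> + 1152 * (1 - \<alpha>^2) * (8 + \<rho>^2)"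
  define D where "D = 10368 * (1 - \<alpha>^2) * \<rho> + 7776 * \<alpha>^2"
  have \<alpha>: "0 \<le> \<alpha>" "\<alpha> \<le> 1" and \<rho>: "0 \<le> \<rho>" "\<rho> \<le> 1" and \<eta>: "0 \<le> \<eta>" "\<eta> \<le> 1"
    using assms by (simp_all add: \<alpha>_def \<rho>_def \<eta>_def)
  have sq: "\<alpha>^2 \<le> 1" "\<rho>^2 \<le> 1" "\<eta>^2 \<le> 1"
    using \<alpha> \<rho> \<eta> by (simp_all add: power_le_one)
  have cnj: "a * cnj a = of_real (\<alpha>^2)" "x * cnj x = of_real (\<rho>^2)" "y * cnj y = of_real (\<eta>^2)"
    by (simp_all add: \<alpha>_def \<rho>_def \<eta>_def flip: complex_norm_square)
  \<comment> \<open>The factors 1 - |a|^2 and their like are nonnegative reals, so their norms are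
    kept exactly; the triangle inequality would give 1 + |a|^2.\<close>
  have "norm (k - of_real r :: complex) \<le> k - r" if "r \<le> k" for k r :: real
    using that norm_of_real[of "k - r", where 'a = complex] by simp
  from this[of "\<alpha>^2" 1] this[of "\<rho>^2" 1] this[of "\<eta>^2" 1] this[of "52 * \<alpha>^2" 201] sq
  have one_minus: "norm (1 - a * cnj a) \<le> 1 - \<alpha>^2" "norm (1 - x * cnj x) \<le> 1 - \<rho>^2"
      "norm (1 - y * cnj y) \<le> 1 - \<eta>^2"
    and lin: "norm (201 - 52 * (a * cnj a)) \<le> 201 - 52 * \<alpha>^2"
    unfolding cnj by simp_all
  have norm_q: "norm (a * cnj a) \<le> \<alpha>^2" "norm ((a * cnj a)^2) \<le> \<alpha>^4" "norm (x * cnj x) \<le> \<rho>^2"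
    using \<alpha> by (simp_all add: norm_mult norm_power \<alpha>_def \<rho>_def power2_eq_square power_numeral_reduce)
  \<comment> \<open>The lone factor 1 is the bound for |u|; it keeps the right-hand side in the
    shape of \<open>hankel_poly_schur\<close>, as the \<open>intro\<close> rules require.\<close>
  have "norm (331776 * ?H) \<le> 1099 * \<alpha>^6 + (1 - \<alpha>^2) *
      (A + (1 - \<rho>^2) * (\<eta> * B + (\<eta>^2 * C + (1 - \<eta>^2) * 1 * D)))"
    unfolding hankel_poly_schur[OF refl refl] A_def B_def C_def D_def
    by (intro norm_triangle_mono norm_diff_mono norm_mult_mono one_minus lin norm_q)
      (simp_all add: norm_power \<alpha>_def \<rho>_def \<eta>_def assms)
  also have "\<dots> \<le> 1099 * \<alpha>^6 + (1 - \<alpha>^2) * (9216 + 8117 * \<alpha>^2 + 8117 * \<alpha>^4)"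
  proof (intro add_left_mono mult_left_mono)
    \<comment> \<open>\<open>B\<close> carries the weight \<eta>. Raising it to 1 = \<eta>^2 + (1 -
      \<eta>^2) distributes \<open>B\<close> over both bounds.\<close>
    have "B \<ge> 0"
      unfolding B_def using \<alpha> \<rho> sq by (intro add_nonneg_nonneg mult_nonneg_nonneg) auto
    hence "(1 - \<rho>^2) * (\<eta> * B) \<le> (1 - \<rho>^2) * B"
      using \<eta> sq by (intro mult_left_mono mult_left_le_one_le) auto
    moreover have "\<eta>^2 * (A + (1 - \<rho>^2) * (B + C)) \<le> \<eta>^2 * (9216 + 8117 * \<alpha>^2 + 8117 * \<alpha>^4)"
      using hankel_bound_C[OF \<alpha> \<rho>] by (intro mult_left_mono) (simp_all add: A_def B_def C_def add_ac)
    moreover have "(1 - \<eta>^2) * (A + (1 - \<rho>^2) * (B + D)) \<le> (1 - \<eta>^2) * (9216 + 8117 * \<alpha>^2 + 8117 * \<alpha>^4)"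
      using hankel_bound_D[OF \<alpha> \<rho>] sq by (intro mult_left_mono) (simp_all add: A_def B_def D_def add_ac)
    ultimately show "A + (1 - \<rho>^2) * (\<eta> * B + (\<eta>^2 * C + (1 - \<eta>^2) * 1 * D))
        \<le> 9216 + 8117 * \<alpha>^2 + 8117 * \<alpha>^4"
      by (simp add: algebra_simps)
  qed (use sq in simp)
  \<comment> \<open>The \<alpha>^4 terms cancel, and 9216 = 331776 / 36.\<close>
  also have "\<dots> = 9216 - 1099 * \<alpha>^2 - 7018 * \<alpha>^6"
    by (simp add: algebra_simps power_numeral_reduce)
  also have "\<dots> \<le> 9216"
    using zero_le_power2[of \<alpha>] zero_le_power[OF \<alpha>(1), of 6] by linarith
  finally show ?thesis
    by (simp add: norm_mult)
qed

section \<open>From the coefficients of the Schwarz function to those of f\<close>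

lemma csqrt_tanh_comp_holomorphic:
  assumes "schwarz_function w"
  shows "(\<lambda>z. csqrt (1 + tanh (w z))) holomorphic_on ball 0 1"
proof -
  have "w ` ball 0 1 \<subseteq> ball 0 1"
    using assms by (force simp: schwarz_function_def)
  thus ?thesis
    using holomorphic_on_compose_gen[OF _ csqrt_tanh_holomorphic] assms
    by (auto simp: o_def schwarz_function_def)
qed

text \<open>As p^2 = 1 + tanh w and tanh' = 1 - tanh^2, differentiation gives 2 p p' = (1 - (p^2 -
  1)^2) w' = p^2 (2 - p^2) w'. Since p has no zero, 2 p' = p (2 - p^2) w', and this equation
  determines the coefficients of p recursively, without the series of the root or of tanh.\<close>

lemma csqrt_tanh_comp_coeffs:
  assumes "schwarz_function w"
  defines "p \<equiv> \<lambda>z. csqrt (1 + tanh (w z))" and "c \<equiv> taylor_coeff w"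
  shows "taylor_coeff p 0 = 1"
    "taylor_coeff p 1 = c 1 / 2"
    "taylor_coeff p 2 = c 2 / 2 - c 1 ^ 2 / 8"
    "taylor_coeff p 3 = c 3 / 2 - c 1 * c 2 / 4 - 5 * c 1 ^ 3 / 48"
    "taylor_coeff p 4 = c 4 / 2 - (2 * c 1 * c 3 + c 2 ^ 2) / 8 - 5 * c 1 ^ 2 * c 2 / 16
      + 17 * c 1 ^ 4 / 384"
proof -
  have w: "w holomorphic_on ball 0 1" "w 0 = 0"
    using assms(1) by (auto simp: schwarz_function_def)
  have w_less: "norm (w z) < 1" if "norm z < 1" for z
    using assms(1) that by (force simp: schwarz_function_def)
  have P: "p has_fps_expansion fps_expansion p 0"
    unfolding p_def by (intro has_fps_expansion_disc csqrt_tanh_comp_holomorphic assms(1))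
  have ode: "2 * deriv p z = p z * (2 - p z * p z) * deriv w z" if z: "z \<in> ball 0 1" for z
  proof -
    have nz: "cosh (w z) \<noteq> 0" "1 + tanh (w z) \<notin> \<real>\<^sub>\<le>\<^sub>0"
      using one_plus_tanh_slit w_less z by auto
    have w': "(w has_field_derivative deriv w z) (at z)"
      using holomorphic_derivI[OF w(1)] z by auto
    have "((\<lambda>z. 1 + tanh (w z)) has_field_derivative (1 - tanh (w z) ^ 2) * deriv w z) (at z)"
      by (rule derivative_eq_intros w' nz refl)+ simp
    hence "(p has_field_derivative
        inverse (2 * csqrt (1 + tanh (w z))) * ((1 - tanh (w z) ^ 2) * deriv w z)) (at z)"
      unfolding p_def by (intro DERIV_chain'[OF _ has_field_derivative_csqrt] nz)
    hence p': "deriv p z = inverse (2 * p z) * ((1 - tanh (w z) ^ 2) * deriv w z)"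
      by (simp add: DERIV_imp_deriv p_def)
    have "p z * p z = 1 + tanh (w z)"
      by (simp add: p_def flip: power2_eq_square)
    hence tanh: "tanh (w z) = p z * p z - 1" by simp
    have nz_p: "p z \<noteq> 0"
      using nz(2) by (auto simp: p_def)
    have "p z * (2 * deriv p z) = (1 - tanh (w z) ^ 2) * deriv w z"
      unfolding p' using nz_p by simp
    also have "\<dots> = p z * (p z * (2 - p z * p z) * deriv w z)"
      unfolding tanh by (simp add: algebra_simps power2_eq_square)
    finally show ?thesis
      using nz_p by (simp only: mult_cancel_left simp_thms)
  qed
  define P where "P = fps_expansion p 0"
  define W where "W = fps_expansion w 0"
  have W: "w has_fps_expansion W"
    unfolding W_def using w(1) by (intro has_fps_expansion_disc) auto
  have "fps_const 2 * fps_deriv P = P * (fps_const 2 - P * P) * fps_deriv W"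
    by (rule has_fps_expansion_disc_eqI[where f = "\<lambda>z. 2 * deriv p z" and
          g = "\<lambda>z. p z * (2 - p z * p z) * deriv w z"])
      (auto intro!: fps_expansion_intros P[folded P_def] W simp: ode)
  hence eq: "fps_nth (fps_const 2 * fps_deriv P) n =
      fps_nth (P * (fps_const 2 - P * P) * fps_deriv W) n" for n
    by simp
  have p0: "taylor_coeff p 0 = 1"
    using w(2) by (simp add: taylor_coeff_def fps_expansion_def p_def)
  have tc: "taylor_coeff p = fps_nth P" "c = fps_nth W"
    by (auto simp: P_def W_def c_def taylor_coeff_def)
  show "taylor_coeff p 0 = 1" by (fact p0)
  have P0: "fps_nth P 0 = 1" using p0 by (simp add: tc)
  have P1: "fps_nth P 1 = fps_nth W 1 / 2"
    using eq[of 0] by (simp add: fps_mult_nth_le_5 P0 field_simps del: One_nat_def)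
  have P2: "fps_nth P 2 = (2 * fps_nth W 2 - fps_nth P 1 * fps_nth W 1) / 4"
    using eq[of 1]
    by (simp add: fps_mult_nth_le_5 P0 field_simps power2_eq_square del: One_nat_def)
  have P3: "fps_nth P 3 = (3 * fps_nth W 3 - 2 * fps_nth P 1 * fps_nth W 2
      - (fps_nth P 2 + 3 * fps_nth P 1 ^ 2) * fps_nth W 1) / 6"
    using eq[of 2]
    by (simp add: fps_mult_nth_le_5 P0 field_simps power2_eq_square del: One_nat_def)
  have P4: "fps_nth P 4 = (4 * fps_nth W 4 - 3 * fps_nth P 1 * fps_nth W 3
      - 2 * (fps_nth P 2 + 3 * fps_nth P 1 ^ 2) * fps_nth W 2
      - (fps_nth P 3 + 6 * fps_nth P 1 * fps_nth P 2 + fps_nth P 1 ^ 3) * fps_nth W 1) / 8"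
    using eq[of 3]
    by (simp add: fps_mult_nth_le_5 P0 field_simps power2_eq_square power3_eq_cube del: One_nat_def)
  show "taylor_coeff p 1 = c 1 / 2"
    unfolding tc by (fact P1)
  show "taylor_coeff p 2 = c 2 / 2 - c 1 ^ 2 / 8"
    unfolding tc P2 P1 by (simp add: field_simps power2_eq_square)
  show "taylor_coeff p 3 = c 3 / 2 - c 1 * c 2 / 4 - 5 * c 1 ^ 3 / 48"
    unfolding tc P3 P2 P1 by (simp add: field_simps power2_eq_square power3_eq_cube)
  show "taylor_coeff p 4 = c 4 / 2 - (2 * c 1 * c 3 + c 2 ^ 2) / 8 - 5 * c 1 ^ 2 * c 2 / 16
      + 17 * c 1 ^ 4 / 384"
    unfolding tc P4 P3 P2 P1 by (simp add: field_simps power_numeral_reduce)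
qed

text \<open>The coefficient of index n in z f' = f p reads (n - 1) a_n = a_1 p_(n-1) + ... + a_(n-1)
  p_1, because p_0 = 1. This yields a_2, ..., a_5 in turn, which are substituted into
  H_3(1).\<close>

lemma hankel_det_eq_hankel_poly:
  assumes "f \<in> class_A" "schwarz_function w"
    "\<And>z. z \<in> ball 0 1 \<Longrightarrow> z * deriv f z = f z * csqrt (1 + tanh (w z))"
  shows "hankel_det f 3 1 =
    hankel_poly (taylor_coeff w 1) (taylor_coeff w 2) (taylor_coeff w 3) (taylor_coeff w 4)"
proof -
  define p where "p = (\<lambda>z. csqrt (1 + tanh (w z)))"
  define F where "F = fps_expansion f 0"
  define P where "P = fps_expansion p 0"
  have F: "f has_fps_expansion F"
    using assms(1) unfolding F_def by (intro has_fps_expansion_disc) (simp add: class_A_def)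
  have P: "p has_fps_expansion P"
    unfolding P_def p_def by (intro has_fps_expansion_disc csqrt_tanh_comp_holomorphic assms(2))
  have ode: "z * deriv f z = f z * p z" if "z \<in> ball 0 1" for z
    using assms(3)[OF that] by (simp add: p_def)
  have "fps_X * fps_deriv F = F * P"
    by (rule has_fps_expansion_disc_eqI[where f = "\<lambda>z. z * deriv f z" and g = "\<lambda>z. f z * p z"])
      (auto intro!: fps_expansion_intros F P simp: ode)
  hence eq: "fps_nth (fps_X * fps_deriv F) n = fps_nth (F * P) n" for n
    by simp
  have tc: "taylor_coeff f = fps_nth F" "fps_nth P = taylor_coeff p"
    by (auto simp: F_def P_def taylor_coeff_def)
  note P_coeffs = csqrt_tanh_comp_coeffs[OF assms(2), folded p_def]
  have F01: "fps_nth F 0 = 0" "fps_nth F 1 = 1"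
    using class_A_coeffs(3,4)[OF assms(1)] by (simp_all only: tc)
  have F2: "fps_nth F 2 = taylor_coeff p 1"
    using eq[of 2]
    by (simp add: fps_mult_nth_le_5 F01 tc P_coeffs(1) del: One_nat_def)
  have F3: "fps_nth F 3 = (taylor_coeff p 2 + fps_nth F 2 * taylor_coeff p 1) / 2"
    using eq[of 3]
    by (simp add: fps_mult_nth_le_5 F01 tc P_coeffs(1) field_simps del: One_nat_def)
  have F4: "fps_nth F 4 =
      (taylor_coeff p 3 + fps_nth F 2 * taylor_coeff p 2 + fps_nth F 3 * taylor_coeff p 1) / 3"
    using eq[of 4]
    by (simp add: fps_mult_nth_le_5 F01 tc P_coeffs(1) field_simps del: One_nat_def)
  have F5: "fps_nth F 5 =
      (taylor_coeff p 4 + fps_nth F 2 * taylor_coeff p 3 + fps_nth F 3 * taylor_coeff p 2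
        + fps_nth F 4 * taylor_coeff p 1) / 4"
    using eq[of 5]
    by (simp add: fps_mult_nth_le_5 F01 tc P_coeffs(1) field_simps del: One_nat_def)
  show ?thesis
    unfolding hankel_det_3_1[OF assms(1)] tc F5 F4 F3 F2 P_coeffs hankel_poly_def
    by (simp add: field_simps power_numeral_reduce del: One_nat_def)
qed

text \<open>Writing w(z) = z v(z) shifts the indices by one, so the Schur parameters of v describe
  c1, ..., c4.\<close>

lemma norm_hankel_poly_schwarz_le:
  assumes "schwarz_function w"
  shows "norm (hankel_poly (taylor_coeff w 1) (taylor_coeff w 2) (taylor_coeff w 3) (taylor_coeff w 4))
    \<le> 1 / 36"
proof -
  have w: "w holomorphic_on ball 0 1" "w 0 = 0"
    using assms by (auto simp: schwarz_function_def)
  have "norm (w z) < 1" if "norm z < 1" for z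
    using assms that by (force simp: schwarz_function_def)
  then obtain v where v: "schur_function v" "\<And>z. z \<in> ball 0 1 \<Longrightarrow> w z = z * v z"
    using schwarz_quotient[OF w] by metis
  have "v has_fps_expansion fps_expansion v 0"
    using v(1) by (intro has_fps_expansion_disc) (simp add: schur_function_def)
  hence "(\<lambda>z. z * v z) has_fps_expansion fps_X * fps_expansion v 0"
    by (intro fps_expansion_intros)
  with has_fps_expansion_disc[OF w(1)] have "fps_expansion w 0 = fps_X * fps_expansion v 0"
    using v(2) by (rule has_fps_expansion_disc_eqI)
  hence shift: "taylor_coeff w (Suc n) = taylor_coeff v n" for n
    by (simp add: taylor_coeff_def)
  have "taylor_coeff w 1 = taylor_coeff v 0" "taylor_coeff w 2 = taylor_coeff v 1"
    "taylor_coeff w 3 = taylor_coeff v 2" "taylor_coeff w 4 = taylor_coeff v 3"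
    using shift[of 0] shift[of 1] shift[of 2] shift[of 3] by (simp_all add: eval_nat_numeral)
  moreover obtain a x y u where "norm a \<le> 1" "norm x \<le> 1" "norm y \<le> 1" "norm u \<le> 1"
    "taylor_coeff v 0 = a"
    "taylor_coeff v 1 = (1 - a * cnj a) * x"
    "taylor_coeff v 2 = (1 - a * cnj a) * ((1 - x * cnj x) * y - cnj a * x^2)"
    "taylor_coeff v 3 = (1 - a * cnj a) *
      ((1 - x * cnj x) * ((1 - y * cnj y) * u - cnj x * y^2 - 2 * cnj a * x * y) + (cnj a)^2 * x^3)"
    using schur_parameters[OF v(1)] by metis
  ultimately show ?thesis
    using norm_hankel_poly_le[of a x y u] by (simp only:)
qed

section \<open>Existence of functions with a prescribed Schwarz function\<close>

lemma class_A_I: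
  assumes "f holomorphic_on ball 0 1" "f 0 = 0" "deriv f 0 = 1"
  shows "f \<in> class_A"
proof -
  have "(\<lambda>n. taylor_coeff f (n + 2) * z ^ (n + 2)) sums (f z - z)" if z: "z \<in> ball 0 1" for z
  proof -
    have "(\<lambda>n. taylor_coeff f n * z ^ n) sums f z"
      using holomorphic_power_series[OF assms(1) z] by (simp add: taylor_coeff_def fps_expansion_def)
    hence "(\<lambda>n. taylor_coeff f (n + 2) * z ^ (n + 2)) sums
        (f z - (\<Sum>i<2. taylor_coeff f i * z ^ i))"
      using sums_iff_shift'[of "\<lambda>n. taylor_coeff f n * z ^ n" 2 "f z"] by blast
    thus ?thesis
      using assms(2,3) by (simp add: taylor_coeff_def fps_expansion_def numeral_2_eq_2)
  qed
  thus ?thesis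
    using assms(1) by (simp add: class_A_def)
qed

text \<open>The equation z f' / f = p is solved by f(z) = z exp (k(z) - k(0)) with k' = (p - 1) / z.
  The exponential factor has no zero, so f vanishes only at 0 and the quotient takes no junk
  value.\<close>

lemma S_B_member_with_schwarz_function:
  assumes "schwarz_function w"
  obtains f where "f \<in> S_B"
    "\<And>z. z \<in> ball 0 1 \<Longrightarrow> z * deriv f z = f z * csqrt (1 + tanh (w z))"
proof -
  define p where "p = (\<lambda>z. csqrt (1 + tanh (w z)))"
  have p: "p holomorphic_on ball 0 1" "p 0 = 1"
    using csqrt_tanh_comp_holomorphic[OF assms] assms by (auto simp: p_def schwarz_function_def)
  have "(\<lambda>z. p z - 1) holomorphic_on ball 0 1" "p 0 - 1 = 0"
    using p by (auto intro: holomorphic_intros)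
  then obtain h where h: "h holomorphic_on ball 0 1" "\<And>z. norm z < 1 \<Longrightarrow> p z - 1 = z * h z"
    by (rule Schwarz3) blast
  obtain k where "\<And>z. z \<in> ball 0 1 \<Longrightarrow> (k has_field_derivative h z) (at z within ball 0 1)"
    using holomorphic_convex_primitive'[OF convex_ball open_ball h(1)] by blast
  hence k: "(k has_field_derivative h z) (at z)" if "z \<in> ball 0 1" for z
    using that by (metis at_within_open open_ball)
  define f where "f = (\<lambda>z. z * exp (k z - k 0))"
  have f': "(f has_field_derivative exp (k z - k 0) * p z) (at z)" if z: "z \<in> ball 0 1" for z
  proof -
    have "p z = 1 + z * h z" using h(2)[of z] z by (simp add: algebra_simps)
    thus ?thesis
      unfolding f_def by (auto intro!: derivative_eq_intros k[OF z] simp: algebra_simps)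
  qed
  have f: "f \<in> class_A"
  proof (rule class_A_I)
    show "f holomorphic_on ball 0 1"
      unfolding holomorphic_on_open[OF open_ball] using f' by blast
    show "deriv f 0 = 1"
      using DERIV_imp_deriv[OF f'[of 0]] p(2) by simp
  qed (simp add: f_def)
  have ode: "z * deriv f z = f z * p z" if "z \<in> ball 0 1" for z
    using DERIV_imp_deriv[OF f'[OF that]] by (simp add: f_def)
  have quot: "starlike_quotient f z = p z" if "z \<in> ball 0 1" for z
  proof (cases "z = 0")
    case False
    hence "f z \<noteq> 0" by (simp add: f_def)
    thus ?thesis
      using ode[OF that] False by (simp add: starlike_quotient_def)
  qed (simp add: starlike_quotient_def p(2))
  hence "starlike_quotient f holomorphic_on ball 0 1"
    by (intro holomorphic_transform[OF p(1)]) (simp add: quot)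
  moreover have "\<forall>z\<in>ball 0 1. starlike_quotient f z = csqrt (1 + tanh (w z))"
    using quot by (simp add: p_def)
  ultimately have "starlike_quotient f \<prec>\<^sub>D (\<lambda>z. csqrt (1 + tanh z))"
    unfolding subordinate_def using csqrt_tanh_holomorphic assms by blast
  with f have "f \<in> S_B"
    by (simp add: S_B_def)
  thus ?thesis
    by (rule that) (use ode in \<open>simp add: p_def\<close>)
qed

theorem theorem2p5:
  shows "(\<forall>f\<in>S_B. norm (hankel_det f 3 1) \<le> 1 / 36) \<and>
    (\<exists>f\<in>S_B. norm (hankel_det f 3 1) = 1 / 36)"
proof (intro conjI ballI)
  fix f assume "f \<in> S_B"
  hence f: "f \<in> class_A" and "starlike_quotient f \<prec>\<^sub>D (\<lambda>z. csqrt (1 + tanh z))"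
    by (simp_all add: S_B_def)
  then obtain w where w: "schwarz_function w"
    and quot: "\<forall>z\<in>ball 0 1. starlike_quotient f z = csqrt (1 + tanh (w z))"
    unfolding subordinate_def by blast
  have "z * deriv f z = f z * csqrt (1 + tanh (w z))" if z: "z \<in> ball 0 1" for z
  proof (cases "z = 0")
    case True
    thus ?thesis using class_A_coeffs(1)[OF f] by simp
  next
    case False
    \<comment> \<open>At a zero of f the quotient would be x / 0 = 0. The root is nonzero there, so
      f has no zero besides the origin and the division can be undone.\<close>
    have "norm (w z) < 1"
      using w z by (force simp: schwarz_function_def)
    hence "csqrt (1 + tanh (w z)) \<noteq> 0"
      using one_plus_tanh_slit(2)[of "w z"] by auto
    moreover have eq: "z * deriv f z / f z = csqrt (1 + tanh (w z))"
      using bspec[OF quot z] False by (simp add: starlike_quotient_def)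
    ultimately have "f z \<noteq> 0" by auto
    with eq show ?thesis
      by (simp add: divide_eq_eq mult.commute)
  qed
  thus "norm (hankel_det f 3 1) \<le> 1 / 36"
    using hankel_det_eq_hankel_poly[OF f w] norm_hankel_poly_schwarz_le[OF w] by simp
next
  \<comment> \<open>With c3 = 1 and the other coefficients 0, only - 9216 * c3^2 survives in
    \<open>hankel_poly\<close>, which gives - 1 / 36.\<close>
  define w :: "complex \<Rightarrow> complex" where "w = (\<lambda>z. z ^ 3)"
  have "norm (z ^ 3) \<le> norm z" if "norm z < 1" for z :: complex
    using power_decreasing[of 1 3 "norm z"] that by (simp add: norm_power)
  hence w: "schwarz_function w"
    by (auto simp: schwarz_function_def w_def intro!: holomorphic_intros)
  have "w has_fps_expansion fps_X ^ 3"
    unfolding w_def by (intro fps_expansion_intros)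
  hence coeffs: "taylor_coeff w n = (if n = 3 then 1 else 0)" for n
    by (simp add: taylor_coeff_def fps_expansion_eqI fps_X_power_nth)
  obtain f where f: "f \<in> S_B"
    "\<And>z. z \<in> ball 0 1 \<Longrightarrow> z * deriv f z = f z * csqrt (1 + tanh (w z))"
    using S_B_member_with_schwarz_function[OF w] by blast
  have "hankel_det f 3 1 = - 1 / 36"
    using hankel_det_eq_hankel_poly[OF _ w f(2)] f(1)
    by (simp add: S_B_def coeffs hankel_poly_def)
  thus "\<exists>f\<in>S_B. norm (hankel_det f 3 1) = 1 / 36"
    using f(1) by (intro bexI[of _ f]) (simp_all add: norm_divide)
qed

end
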